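(* $\lim_{n\to\infty} n^{-2} f^{(3)}(n;5,3)=\frac{1}{5}$; that is, the limit exists and equals $\frac15$.
   Context: An $r$-graph is an $r$-uniform hypergraph (a finite vertex set together with a set of distinct $r$-element subsets, called edges). For a family $\mathcal{F}$ of $r$-graphs, an $r$-graph is $\mathcal{F}$-free if it has no (not necessarily induced) subgraph isomorphic to a member of $\mathcal{F}$, and $ex(n;\mathcal{F})$ denotes the maximum number of edges in an $\mathcal{F}$-free $r$-graph on $n$ vertices. $\mathcal{F}^{(r)}(k,s)$ denotes the family of all $r$-graphs on $k$ vertices with $s$ edges (isolated vertices are allowed), and $f^{(r)}(n;k,s):=ex(n;\mathcal{F}^{(r)}(k,s))$. *)

theory Defs
  imports Complex_Main
begin

type_synonym 'a hgraph = "'a set \<times> 'a set set"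

abbreviation verts :: "'a hgraph \<Rightarrow> 'a set" where
  "verts G \<equiv> fst G"

abbreviation edges :: "'a hgraph \<Rightarrow> 'a set set" where
  "edges G \<equiv> snd G"

definition rgraph :: "nat \<Rightarrow> 'a hgraph \<Rightarrow> bool" where
  "rgraph r G \<longleftrightarrow> finite (verts G) \<and> (\<forall>e\<in>edges G. e \<subseteq> verts G \<and> card e = r)"

definition subgraph :: "'a hgraph \<Rightarrow> 'a hgraph \<Rightarrow> bool" where
  "subgraph H G \<longleftrightarrow>
     verts H \<subseteq> verts G \<and> edges H \<subseteq> edges G \<and> (\<forall>e\<in>edges H. e \<subseteq> verts H)"

definition isomorphic :: "'a hgraph \<Rightarrow> 'b hgraph \<Rightarrow> bool" where
  "isomorphic G H \<longleftrightarrow>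
     (\<exists>\<phi>. bij_betw \<phi> (verts G) (verts H) \<and> (\<lambda>e. \<phi> ` e) ` edges G = edges H)"

definition free_of :: "'b hgraph set \<Rightarrow> 'a hgraph \<Rightarrow> bool" where
  "free_of \<F> G \<longleftrightarrow> (\<forall>F\<in>\<F>. \<nexists>H. subgraph H G \<and> isomorphic H F)"

text \<open>
  Every finite hypergraph is isomorphic to one whose vertices are natural numbers, so both the
  host graphs in \<open>ex_num\<close> and the members of \<open>graph_family\<close> are taken with vertices of type nat.
  If the family has a member that embeds in every \<open>r\<close>-graph on \<open>n\<close> vertices, then the set
  below is empty and the value of \<open>ex_num\<close> is unspecified; \<open>ex_num_well_defined\<close> shows
  that this does not happen for \<open>graph_family r k s\<close> with \<open>s > 0\<close>.
\<close>

definition ex_num :: "nat \<Rightarrow> nat \<Rightarrow> nat hgraph set \<Rightarrow> nat" where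
  "ex_num r n \<F> =
     Max {card (edges G) | G :: nat hgraph. rgraph r G \<and> card (verts G) = n \<and> free_of \<F> G}"

definition graph_family :: "nat \<Rightarrow> nat \<Rightarrow> nat \<Rightarrow> nat hgraph set" where
  "graph_family r k s = {F. rgraph r F \<and> card (verts F) = k \<and> card (edges F) = s}"

definition f_num :: "nat \<Rightarrow> nat \<Rightarrow> nat \<Rightarrow> nat \<Rightarrow> nat" where
  "f_num r n k s = ex_num r n (graph_family r k s)"

lemma ex_num_well_defined:
  fixes r n k s :: nat
  defines "S \<equiv> {card (edges G) | G :: nat hgraph.
                  rgraph r G \<and> card (verts G) = n \<and> free_of (graph_family r k s) G}"
  assumes "s > 0"
  shows "finite S" and "S \<noteq> {}"
proof -
  have "card (edges G) \<le> 2 ^ n" if "rgraph r G" "card (verts G) = n" for G :: "nat hgraph"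
  proof -
    have "edges G \<subseteq> Pow (verts G)" "finite (Pow (verts G))"
      using that by (auto simp: rgraph_def)
    then have "card (edges G) \<le> card (Pow (verts G))"
      by (rule card_mono[rotated])
    then show ?thesis
      using that by (simp add: rgraph_def card_Pow)
  qed
  then have "S \<subseteq> {..2 ^ n}"
    by (auto simp: S_def)
  then show "finite S"
    by (rule finite_subset) simp
  have "free_of (graph_family r k s) ({..<n}, {})"
    using assms(2) by (auto simp: free_of_def graph_family_def subgraph_def isomorphic_def)
  then have "card (edges ({..<n}, {} :: nat set set)) \<in> S"
    unfolding S_def by (intro CollectI exI[of _ "({..<n}, {} :: nat set set)"]) (simp add: rgraph_def)
  then show "S \<noteq> {}"
    by blast
qed

end

theory Submission
  imports Defs
begin

text \<open>
  Two triples on a common pair form a twin \<open>abc, abd\<close>; if no three triples lie on five points,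
  every pair is covered by at most two triples and every triple lies in at most one twin. Counting
  covered pairs, a twin uses five of them and a triple without twin uses three, which gives the
  upper bound \<open>2/5\<close> per pair.

  For the lower bound, split the vertex set as \<open>U \<union> W\<close> with \<open>W\<close> of size \<open>w = n div 3\<close>. Colour the
  pairs \<open>ab\<close> of \<open>W\<close> properly with \<open>w\<close> colours (by \<open>a + b mod w\<close>), choose \<open>w\<close> disjoint pairs
  \<open>c\<^sub>i d\<^sub>i\<close> in \<open>U\<close>, and take the twin \<open>abc\<^sub>i, abd\<^sub>i\<close> whenever \<open>ab\<close> has colour \<open>i\<close>. These twins cover
  no pair twice and almost every pair not inside \<open>U\<close>. Inside \<open>U\<close> one proceeds recursively,
  discarding the at most \<open>2w\<close> triples that contain some \<open>c\<^sub>i d\<^sub>i\<close>. The loss is linear in \<open>n\<close>.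
\<close>

section \<open>Freeness as a condition on unions of three triples\<close>

definition spread :: "'a set set \<Rightarrow> bool" where
  "spread E \<longleftrightarrow> (\<forall>A\<in>E. \<forall>B\<in>E. \<forall>C\<in>E. A \<noteq> B \<longrightarrow> A \<noteq> C \<longrightarrow> B \<noteq> C \<longrightarrow> 6 \<le> card (A \<union> B \<union> C))"

lemma spreadD:
  "\<lbrakk>spread E; A \<in> E; B \<in> E; C \<in> E; A \<noteq> B; A \<noteq> C; B \<noteq> C\<rbrakk> \<Longrightarrow> 6 \<le> card (A \<union> B \<union> C)"
  by (auto simp: spread_def)

text \<open>Three edges whose union has at most five points can be padded to exactly five vertices
  of \<open>G\<close>, which is where \<open>5 <= card (verts G)\<close> enters. The hosts live on
  natural numbers, so the resulting subgraph is itself a member of the family.\<close>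

lemma free_of_imp_spread:
  fixes G :: "nat hgraph"
  assumes G: "rgraph 3 G" and n: "5 \<le> card (verts G)"
    and free: "free_of (graph_family 3 5 3) G"
  shows "spread (edges G)"
  unfolding spread_def
proof (intro ballI impI, rule ccontr)
  fix A B C assume ABC: "A \<in> edges G" "B \<in> edges G" "C \<in> edges G" "A \<noteq> B" "A \<noteq> C" "B \<noteq> C"
    and small: "\<not> 6 \<le> card (A \<union> B \<union> C)"
  have "A \<union> B \<union> C \<subseteq> verts G" and "finite (verts G)"
    using G ABC by (auto simp: rgraph_def)
  moreover have "card (A \<union> B \<union> C) \<le> 5"
    using small by simp
  ultimately obtain S where S: "A \<union> B \<union> C \<subseteq> S" "S \<subseteq> verts G" "card S = 5"
    using exists_subset_between n by metis
  from this(3) have "finite S"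
    by (simp add: card_ge_0_finite)
  let ?H = "(S, {A, B, C})"
  have "?H \<in> graph_family 3 5 3"
    using S \<open>finite S\<close> ABC G by (auto simp: graph_family_def rgraph_def)
  moreover have "subgraph ?H G"
    using S ABC by (auto simp: subgraph_def)
  moreover have "isomorphic ?H ?H"
    unfolding isomorphic_def by (intro exI[of _ id]) auto
  ultimately show False
    using free by (auto simp: free_of_def)
qed

lemma spread_imp_free_of:
  assumes "spread (edges G)"
  shows "free_of (graph_family r 5 3) G"
  unfolding free_of_def
proof (intro ballI notI, elim exE conjE)
  fix F H assume F: "F \<in> graph_family r 5 3" and H: "subgraph H G" and iso: "isomorphic H F"
  obtain \<phi> where \<phi>: "bij_betw \<phi> (verts H) (verts F)" "(\<lambda>e. \<phi> ` e) ` edges H = edges F"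
    using iso by (auto simp: isomorphic_def)
  have card_verts: "card (verts H) = 5"
    using F bij_betw_same_card[OF \<phi>(1)] by (simp add: graph_family_def)
  \<comment> \<open>\<open>\<phi>\<close> is injective only on \<open>verts H\<close>; the clause in
    \<open>subgraph\<close> that edges lie inside \<open>verts H\<close> lifts this to edges, so no
    two of them are merged.\<close>
  have "inj_on (\<lambda>e. \<phi> ` e) (edges H)"
    using H inj_on_image_eq_iff[OF bij_betw_imp_inj_on[OF \<phi>(1)]]
    by (auto simp: inj_on_def subgraph_def)
  then have "card (edges H) = 3"
    using F \<phi>(2) card_image by (fastforce simp: graph_family_def)
  then obtain A B C where ABC: "edges H = {A, B, C}" "A \<noteq> B" "A \<noteq> C" "B \<noteq> C"
    by (auto simp: card_3_iff)
  have "A \<union> B \<union> C \<subseteq> verts H" and "finite (verts H)"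
    using H ABC card_verts by (auto simp: subgraph_def intro: card_ge_0_finite)
  then have "card (A \<union> B \<union> C) \<le> 5"
    using card_mono card_verts by metis
  moreover have "6 \<le> card (A \<union> B \<union> C)"
    using H ABC by (intro spreadD[OF assms]) (auto simp: subgraph_def)
  ultimately show False by simp
qed

text \<open>Inclusion-exclusion leaves only twins to check. If all pairwise intersections have at
  most one point, two triples span at least 5 points and the third adds at least 3 - 2. A twin spans
  4 points, so the third triple must add two more.\<close>

lemma spreadI:
  assumes triples: "\<And>A. A \<in> E \<Longrightarrow> card A = 3"
    and twins: "\<And>A B C. \<lbrakk>A \<in> E; B \<in> E; C \<in> E; A \<noteq> B; A \<noteq> C; B \<noteq> C; 2 \<le> card (A \<inter> B)\<rbrakk>
      \<Longrightarrow> card (C \<inter> (A \<union> B)) \<le> 1"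
  shows "spread E"
  unfolding spread_def
proof (intro ballI impI)
  fix A B C assume E: "A \<in> E" "B \<in> E" "C \<in> E" and ne: "A \<noteq> B" "A \<noteq> C" "B \<noteq> C"
  have fin: "finite X" if "X \<in> E" for X
    using triples[OF that] by (simp add: card_ge_0_finite)
  have inter: "card (X \<inter> Y) \<le> 2" if "X \<in> E" "Y \<in> E" "X \<noteq> Y" for X Y
  proof -
    have "X \<inter> Y \<subset> X"
      using that triples card_subset_eq[OF fin[OF \<open>Y \<in> E\<close>], of X] by auto
    then have "card (X \<inter> Y) < card X"
      by (rule psubset_card_mono[OF fin[OF \<open>X \<in> E\<close>]])
    then show ?thesis
      using triples[OF \<open>X \<in> E\<close>] by simp
  qed
  have union: "card (X \<union> Y) + card (X \<inter> Y) = 6" if "X \<in> E" "Y \<in> E" for X Y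
    using card_Un_Int[OF fin[OF that(1)] fin[OF that(2)]] triples that by simp
  have union3: "card (X \<union> Y \<union> Z) + card (Z \<inter> (X \<union> Y)) = card (X \<union> Y) + 3"
    if "X \<in> E" "Y \<in> E" "Z \<in> E" for X Y Z
    using card_Un_Int[of "X \<union> Y" Z] fin triples that by (simp add: Int_commute)
  have twin: "6 \<le> card (X \<union> Y \<union> Z)"
    if "X \<in> E" "Y \<in> E" "Z \<in> E" "X \<noteq> Y" "X \<noteq> Z" "Y \<noteq> Z" "2 \<le> card (X \<inter> Y)" for X Y Z
    using union3[of X Y Z] union[of X Y] inter[of X Y] twins[of X Y Z] that by linarith
  show "6 \<le> card (A \<union> B \<union> C)"
  proof (cases "2 \<le> card (A \<inter> B) \<or> 2 \<le> card (A \<inter> C) \<or> 2 \<le> card (B \<inter> C)")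
    case True
    moreover have "A \<union> C \<union> B = A \<union> B \<union> C" "B \<union> C \<union> A = A \<union> B \<union> C"
      by auto
    ultimately show ?thesis
      using twin[of A B C] twin[of A C B] twin[of B C A] E ne by metis
  next
    case False
    have "card (C \<inter> (A \<union> B)) \<le> card (A \<inter> C) + card (B \<inter> C)"
      using card_Un_le[of "A \<inter> C" "B \<inter> C"] by (simp add: Int_commute Int_Un_distrib)
    then show ?thesis
      using union3[of A B C] union[of A B] False E by linarith
  qed
qed

section \<open>Upper bound by counting pairs\<close>

lemma card_diff_pair:
  assumes "card A = 3" "p \<subseteq> A" "card p = 2"
  shows "card (A - p) = 1"
  using assms by (simp add: card_Diff_subset card_ge_0_finite finite_subset)

text \<open>Three triples through \<open>p\<close> would each add a single point to it, giving a
  union of at most 2 + 3 = 5 points.\<close>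

lemma spread_codegree:
  assumes triples: "\<And>A. A \<in> E \<Longrightarrow> card A = 3" and E: "spread E" "finite E" and p: "card p = 2"
  shows "card {A \<in> E. p \<subseteq> A} \<le> 2"
proof (rule ccontr)
  assume "\<not> ?thesis"
  then have "3 \<le> card {A \<in> E. p \<subseteq> A}" by simp
  then obtain S where S: "S \<subseteq> {A \<in> E. p \<subseteq> A}" "card S = 3"
    by (meson obtain_subset_with_card_n)
  from S(2) obtain A B C where "S = {A, B, C}" and ne: "A \<noteq> B" "A \<noteq> C" "B \<noteq> C"
    by (auto simp: card_3_iff)
  with S(1) have ABC: "A \<in> E" "B \<in> E" "C \<in> E" "p \<subseteq> A" "p \<subseteq> B" "p \<subseteq> C"
    by auto
  have "A \<union> B \<union> C = p \<union> (A - p) \<union> (B - p) \<union> (C - p)"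
    using ABC by auto
  also have "card \<dots> \<le> card p + card (A - p) + card (B - p) + card (C - p)"
    by (intro order_trans[OF card_Un_le] add_right_mono card_Un_le)
  also have "\<dots> = 5"
    using ABC triples p by (simp add: card_diff_pair)
  finally show False
    using spreadD[OF E(1) ABC(1-3) ne] by simp
qed

text \<open>Suppose \<open>A\<close> had two such pairs. The second triple on each adds one point to
  \<open>A\<close>, so the three triples span at most 3 + 1 + 1 points, provided the two further
  triples differ.\<close>

lemma spread_twin_pair_unique:
  assumes triples: "\<And>A. A \<in> E \<Longrightarrow> card A = 3" and E: "spread E" "A \<in> E"
    and p: "p \<subseteq> A" "card p = 2" "card {B \<in> E. p \<subseteq> B} = 2"
    and q: "q \<subseteq> A" "card q = 2" "card {B \<in> E. q \<subseteq> B} = 2"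
  shows "p = q"
proof (rule ccontr)
  assume "p \<noteq> q"
  have finA: "finite A" using triples[OF E(2)] by (simp add: card_ge_0_finite)
  have other: "\<exists>B\<in>E. r \<subseteq> B \<and> B \<noteq> A" if "card {B \<in> E. r \<subseteq> B} = 2" for r
  proof (rule ccontr)
    assume "\<not> ?thesis"
    then have "{B \<in> E. r \<subseteq> B} \<subseteq> {A}" by auto
    from card_mono[OF _ this] show False using that by simp
  qed
  obtain B where B: "B \<in> E" "p \<subseteq> B" "B \<noteq> A" using other p by blast
  obtain C where C: "C \<in> E" "q \<subseteq> C" "C \<noteq> A" using other q by blast
  have "p \<subset> p \<union> q"
    using \<open>p \<noteq> q\<close> p q finA card_subset_eq[of p q] by (metis finite_subset sup.absorb_iff1 sup_ge1 psubsetI)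
  then have "card p < card (p \<union> q)"
    using p q finA by (meson Un_least finite_subset psubset_card_mono)
  then have pq: "p \<union> q = A"
    using p q triples[OF E(2)] finA by (intro card_seteq) auto
  \<comment> \<open>A common second triple would contain \<open>p \<union> q\<close>, which is all
    of \<open>A\<close>.\<close>
  have "B \<noteq> C"
  proof
    assume "B = C"
    then have "A \<subseteq> B" using pq B C by auto
    then show False using B triples E card_subset_eq[of B A] by (metis card_ge_0_finite zero_less_numeral)
  qed
  have "A \<union> B \<union> C = A \<union> (B - p) \<union> (C - q)"
    using p q by auto
  also have "card \<dots> \<le> card A + card (B - p) + card (C - q)"
    by (intro order_trans[OF card_Un_le] add_right_mono card_Un_le)
  also have "\<dots> = 5"
    using B C p q E triples by (simp add: card_diff_pair)
  finally show False
    using spreadD[OF E(1), of A B C] \<open>B \<noteq> C\<close> B C E by simp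
qed

lemma two_times_choose_two: "2 * (n choose 2) = n * (n - 1)"
  by (cases n) (simp_all add: choose_two)

text \<open>Let \<open>d p\<close> be the codegree of a pair. Counting incidences gives 3 |E| = sum
  of \<open>d p\<close> \<le> |P| + |P2|, and 2 |P2| \<le> |E|. Hence 5 |E| \<le> 2 |P|.\<close>

lemma spread_card_le:
  assumes V: "finite V" and sub: "\<And>A. A \<in> E \<Longrightarrow> A \<subseteq> V" and triples: "\<And>A. A \<in> E \<Longrightarrow> card A = 3"
    and E: "spread E"
  shows "5 * card E \<le> card V * (card V - 1)"
proof -
  define P where "P = {p. p \<subseteq> V \<and> card p = 2}"
  define d where "d p = card {A \<in> E. p \<subseteq> A}" for p
  define P2 where "P2 = {p \<in> P. d p = 2}"
  have fin: "finite P" "finite P2" "finite E"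
    using V sub finite_subset[of E "Pow V"] by (auto simp: P_def P2_def)
  have "(\<Sum>p\<in>P. d p) = (\<Sum>A\<in>E. 3)"
    unfolding d_def
  proof (rule sum_multicount_gen[OF fin(1,3)], rule ballI)
    fix A assume A: "A \<in> E"
    then have "{p \<in> P. p \<subseteq> A} = {p. p \<subseteq> A \<and> card p = 2}"
      using sub by (auto simp: P_def)
    then show "card {p \<in> P. p \<subseteq> A} = 3"
      using A triples by (simp add: n_subsets card_ge_0_finite choose_two)
  qed
  moreover have "(\<Sum>p\<in>P. d p) \<le> (\<Sum>p\<in>P. 1 + (if d p = 2 then 1 else 0))"
  proof (rule sum_mono)
    fix p assume "p \<in> P"
    then have "d p \<le> 2"
      unfolding d_def using spread_codegree[OF triples E fin(3)] by (simp add: P_def)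
    then show "d p \<le> 1 + (if d p = 2 then 1 else 0)"
      by auto
  qed
  moreover have "(\<Sum>p\<in>P. 1 + (if d p = 2 then 1 else 0)) = card P + card P2"
    unfolding P2_def card_eq_sum sum.inter_filter[OF fin(1)] by (rule sum.distrib)
  \<comment> \<open>Each pair in \<open>P2\<close> lies in two triples, while each triple contains
    at most one pair from \<open>P2\<close>.\<close>
  moreover have "2 * card P2 \<le> card E"
  proof -
    have "2 * card P2 = (\<Sum>p\<in>P2. card {A \<in> E. p \<subseteq> A})"
      by (simp add: P2_def flip: d_def)
    also have "\<dots> = (\<Sum>A\<in>E. card {p \<in> P2. p \<subseteq> A})"
      by (rule sum_multicount_gen[OF fin(2,3)]) simp
    also have "\<dots> \<le> (\<Sum>A\<in>E. 1)"
    proof (rule sum_mono)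
      fix A assume "A \<in> E"
      then have "p = q" if "p \<in> {p \<in> P2. p \<subseteq> A}" "q \<in> {p \<in> P2. p \<subseteq> A}" for p q
        using that spread_twin_pair_unique[OF triples E, of A p q]
        by (simp add: P2_def P_def d_def)
      then show "card {p \<in> P2. p \<subseteq> A} \<le> 1"
        using fin(2) by (subst card_le_Suc0_iff_eq[unfolded One_nat_def[symmetric]]) auto
    qed
    finally show ?thesis by simp
  qed
  moreover have "2 * card P = card V * (card V - 1)"
    using V by (simp add: P_def n_subsets two_times_choose_two)
  ultimately show ?thesis by simp
qed

section \<open>Adding twins without creating three triples on five points\<close>

text \<open>
  \<open>col\<close> is a proper edge colouring of the complete graph on \<open>W\<close>, and \<open>D i\<close> is the pair in \<open>U\<close> that
  is joined to all pairs of colour \<open>i\<close>.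
\<close>

lemma spread_twin_extension:
  fixes col :: "'a set \<Rightarrow> 'i"
  assumes disj: "U \<inter> W = {}"
    and proper: "\<And>P Q. \<lbrakk>P \<subseteq> W; Q \<subseteq> W; card P = 2; card Q = 2; P \<inter> Q \<noteq> {}; col P = col Q\<rbrakk> \<Longrightarrow> P = Q"
    and D: "\<And>P. \<lbrakk>P \<subseteq> W; card P = 2\<rbrakk> \<Longrightarrow> D (col P) \<subseteq> U \<and> card (D (col P)) = 2"
    and D_disj: "\<And>P Q. \<lbrakk>P \<subseteq> W; Q \<subseteq> W; card P = 2; card Q = 2; D (col P) \<inter> D (col Q) \<noteq> {}\<rbrakk>
      \<Longrightarrow> col P = col Q"
    and sub: "\<And>A. A \<in> E \<Longrightarrow> A \<subseteq> U" and triples: "\<And>A. A \<in> E \<Longrightarrow> card A = 3" and E: "spread E"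
    and avoid: "\<And>A P. \<lbrakk>A \<in> E; P \<subseteq> W; card P = 2\<rbrakk> \<Longrightarrow> \<not> D (col P) \<subseteq> A"
    and T_def: "T = {insert u P | u P. P \<subseteq> W \<and> card P = 2 \<and> u \<in> D (col P)}"
  shows "spread (E \<union> T)"
proof (rule spreadI)
  have finP: "finite P" if "card P = 2" for P :: "'a set"
    using that by (simp add: card_ge_0_finite)
  \<comment> \<open>Elimination rule for \<open>T\<close>: the apex \<open>u\<close> and the pair
    \<open>P\<close> are recovered as the traces of the triple on \<open>U\<close> and on
    \<open>W\<close>.\<close>
  have TE: thesis
    if A: "A \<in> T" and rule: "\<And>u P. \<lbrakk>A = insert u P; P \<subseteq> W; card P = 2; u \<in> D (col P); u \<in> U;
      u \<notin> W; u \<notin> P; A \<inter> U = {u}; A \<inter> W = P\<rbrakk> \<Longrightarrow> thesis" for A thesis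
  proof -
    obtain u P where *: "A = insert u P" "P \<subseteq> W" "card P = 2" "u \<in> D (col P)"
      using A by (auto simp: T_def)
    have "u \<in> U" using * D by blast
    then have "u \<notin> P" "u \<notin> W" "A \<inter> U = {u}" "A \<inter> W = P"
      unfolding *(1) using *(2) disj by blast+
    then show thesis using rule * \<open>u \<in> U\<close> by metis
  qed
  show "card A = 3" if A: "A \<in> E \<union> T" for A
  proof (cases "A \<in> T")
    case True
    obtain u P where "A = insert u P" "card P = 2" "u \<notin> P" by (rule TE[OF True])
    then show ?thesis using finP by simp
  qed (use A triples in auto)
  \<comment> \<open>With a common apex, disjointness of the \<open>D\<close>-pairs forces equal
    colours, and the \<open>W\<close>-pairs meet, so properness makes them equal. With different
    apexes both shared points lie in \<open>W\<close>.\<close>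
  have share: "A \<inter> W = B \<inter> W" if AB: "A \<in> T" "B \<in> T" "2 \<le> card (A \<inter> B)" for A B
  proof -
    obtain u P where A: "A = insert u P" "P \<subseteq> W" "card P = 2" "u \<in> D (col P)" "u \<in> U"
        "u \<notin> W" "u \<notin> P" and A_int: "A \<inter> U = {u}" "A \<inter> W = P"
      by (rule TE[OF AB(1)])
    obtain v Q where B: "B = insert v Q" "Q \<subseteq> W" "card Q = 2" "v \<in> D (col Q)" "v \<in> U"
        "v \<notin> W" "v \<notin> Q" and B_int: "B \<inter> U = {v}" "B \<inter> W = Q"
      by (rule TE[OF AB(2)])
    show ?thesis
    proof (cases "u = v")
      case True
      then have "A \<inter> B = insert u (P \<inter> Q)" using A B by auto
      then have "P \<inter> Q \<noteq> {}" using AB(3) by auto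
      moreover have "col P = col Q" using A B True D_disj by blast
      ultimately have "P = Q" using proper A B by blast
      then show ?thesis using A_int B_int by simp
    next
      case False
      then have "A \<inter> B = P \<inter> Q" using A B by auto
      then have "2 \<le> card (P \<inter> Q)" using AB(3) by simp
      then have "P \<inter> Q = P" "P \<inter> Q = Q"
        using A(3) B(3) finP by (simp_all add: card_seteq)
      then show ?thesis using A_int B_int by simp
    qed
  qed
  \<comment> \<open>Consequently a new triple is never in a twin with an old one, and it meets the
    union of two old triples in at most one point.\<close>
  have outside: "card (A \<inter> X) \<le> 1" if "A \<in> T" "X \<subseteq> U" for A X
  proof -
    obtain u where "A \<inter> U = {u}" by (rule TE[OF \<open>A \<in> T\<close>]) blast
    then have "A \<inter> X \<subseteq> {u}" using that by auto
    then show ?thesis using card_mono[of "{u}" "A \<inter> X"] by simp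
  qed
  fix A B C
  assume ABC: "A \<in> E \<union> T" "B \<in> E \<union> T" "C \<in> E \<union> T" "A \<noteq> B" "A \<noteq> C" "B \<noteq> C" "2 \<le> card (A \<inter> B)"
  show "card (C \<inter> (A \<union> B)) \<le> 1"
  proof (cases "A \<in> T \<and> B \<in> T")
    case False
    then have "A \<in> E \<and> B \<in> E"
      using ABC outside[of A B] outside[of B A] sub[of A] sub[of B] by (auto simp: Int_commute)
    then have AB: "A \<in> E" "B \<in> E" by auto
    then have finAB: "finite (A \<union> B)"
      using triples by (metis card_ge_0_finite finite_UnI zero_less_numeral)
    show ?thesis
    proof (cases "C \<in> T")
      case True
      then show ?thesis using outside sub AB by simp
    next
      case False
      then have C: "C \<in> E" using ABC by auto
      then have "6 \<le> card (A \<union> B \<union> C)" using spreadD[OF E AB C] ABC by auto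
      moreover have "card (A \<union> B) + card (A \<inter> B) = 6"
        using card_Un_Int[of A B] finAB triples AB by simp
      moreover have "card (A \<union> B \<union> C) + card (C \<inter> (A \<union> B)) = card (A \<union> B) + 3"
        using card_Un_Int[of "A \<union> B" C] finAB triples[OF C] by (simp add: Int_commute card_ge_0_finite)
      ultimately show ?thesis using ABC(7) by linarith
    qed
  next
    case True
    then have AB: "A \<in> T" "B \<in> T" by auto
    obtain u P where A: "A = insert u P" "P \<subseteq> W" "card P = 2" "u \<in> D (col P)" "u \<in> U"
        "u \<notin> W" "u \<notin> P" and A_int: "A \<inter> U = {u}" "A \<inter> W = P"
      by (rule TE[OF AB(1)])
    obtain v Q where B: "B = insert v Q" "Q \<subseteq> W" "card Q = 2" "v \<in> D (col Q)" "v \<in> U"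
        "v \<notin> W" "v \<notin> Q" and B_int: "B \<inter> U = {v}" "B \<inter> W = Q"
      by (rule TE[OF AB(2)])
    have "P = Q" using share[OF AB ABC(7)] A_int B_int by simp
    have "u \<noteq> v" using ABC(4) A(1) B(1) \<open>P = Q\<close> by auto
    \<comment> \<open>Two distinct triples of \<open>T\<close> on the same \<open>W\<close>-pair
      have different apexes, which exhaust the two-point set \<open>D (col P)\<close>.\<close>
    have Duv: "D (col P) = {u, v}"
      using \<open>u \<noteq> v\<close> A(2-4) B(4) \<open>P = Q\<close> D finP card_seteq[of "D (col P)" "{u, v}"] by simp
    show ?thesis
    proof (cases "C \<in> T")
      case False
      then have C: "C \<in> E" using ABC by auto
      \<comment> \<open>An old triple could meet the twin in two points only by containing
        \<open>D (col P)\<close>, and \<open>avoid\<close> excludes this.\<close>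
      have sub2: "C \<inter> (A \<union> B) \<subseteq> {u, v}"
        using sub[OF C] A(1,2) B(1,2) disj by blast
      moreover have "C \<inter> (A \<union> B) \<noteq> {u, v}"
        using avoid[OF C A(2,3)] Duv by auto
      ultimately have "C \<inter> (A \<union> B) \<subset> {u, v}" by blast
      then show ?thesis
        using psubset_card_mono[of "{u, v}" "C \<inter> (A \<union> B)"] \<open>u \<noteq> v\<close> by simp
    next
      case True
      obtain x R where C: "C = insert x R" "R \<subseteq> W" "card R = 2" "x \<in> D (col R)" "x \<in> U"
          "x \<notin> W" "x \<notin> R" and C_int: "C \<inter> U = {x}" "C \<inter> W = R"
        by (rule TE[OF True])
      show ?thesis
      proof (rule ccontr)
        assume "\<not> ?thesis"
        \<comment> \<open>The apex \<open>x\<close> differs from \<open>u\<close> or from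
          \<open>v\<close>, and \<open>A\<close>, \<open>B\<close> agree on \<open>W\<close>; so one
          of the two triples already accounts for the whole intersection. Then \<open>share\<close>
          gives \<open>R = P\<close>, and \<open>C\<close> would be \<open>A\<close> or
          \<open>B\<close>.\<close>
        moreover have "C \<inter> (A \<union> B) = C \<inter> A \<or> C \<inter> (A \<union> B) = C \<inter> B"
          using A(1,2,5,6) B(1,5,6) C(1,2,6) \<open>P = Q\<close> \<open>u \<noteq> v\<close> by blast
        ultimately have "2 \<le> card (C \<inter> A) \<or> 2 \<le> card (C \<inter> B)" by auto
        then have "R = P"
          using share[OF True AB(1)] share[OF True AB(2)] A_int(2) B_int(2) C_int(2) \<open>P = Q\<close> by argo
        then have "x \<in> {u, v}" using C(4) Duv by simp
        then show False using ABC(5,6) A(1) B(1) C(1) \<open>R = P\<close> \<open>P = Q\<close> by auto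
      qed
    qed
  qed
qed

section \<open>The concrete colouring and one extension step\<close>

text \<open>After cancelling the common point, the remaining points are congruent modulo
  \<open>w\<close>; in an interval of length \<open>w\<close> they must coincide.\<close>

lemma sum_mod_proper:
  fixes m w :: nat
  assumes "P \<subseteq> {m..<m + w}" "Q \<subseteq> {m..<m + w}" "card P = 2" "card Q = 2" "P \<inter> Q \<noteq> {}"
    and eq: "\<Sum>P mod w = \<Sum>Q mod w"
  shows "P = Q"
proof -
  have other: "\<exists>y. R = {x, y} \<and> x \<noteq> y" if "card R = 2" "x \<in> R" for R and x :: nat
    using that by (auto simp: card_2_iff)
  obtain x where "x \<in> P" "x \<in> Q" using assms(5) by blast
  obtain y z where yz: "P = {x, y}" "x \<noteq> y" "Q = {x, z}" "x \<noteq> z"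
    using other[OF assms(3) \<open>x \<in> P\<close>] other[OF assms(4) \<open>x \<in> Q\<close>] by blast
  have close: False if "(x + a) mod w = (x + b) mod w" "a < b" "b < a + w" for a b
  proof -
    have "w dvd b - a"
      using that mod_eq_dvd_iff_nat[of "x + a" "x + b" w] by simp
    then show False using that by (auto dest: dvd_imp_le)
  qed
  have "(x + y) mod w = (x + z) mod w" using eq yz by simp
  moreover have "y < z + w" "z < y + w" using yz assms(1,2) by auto
  ultimately have "y = z" using close[of y z] close[of z y] by (cases y z rule: linorder_cases) auto
  then show ?thesis using yz by simp
qed

text \<open>Traces on \<open>W\<close> and \<open>U\<close> make a triple equivalent to a pair
  \<open>P\<close> together with an apex, and every \<open>P\<close> has two apexes.\<close>

lemma card_twin_family:
  assumes W: "finite W" and disj: "U \<inter> W = {}"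
    and D: "\<And>P. \<lbrakk>P \<subseteq> W; card P = 2\<rbrakk> \<Longrightarrow> D (col P) \<subseteq> U \<and> card (D (col P)) = 2"
  shows "card {insert u P | u P. P \<subseteq> W \<and> card P = 2 \<and> u \<in> D (col P)} = card W * (card W - 1)"
proof -
  let ?S = "SIGMA P:{P. P \<subseteq> W \<and> card P = 2}. D (col P)"
  have "inj_on (\<lambda>(P, u). insert u P) ?S"
  proof (rule inj_onI, clarify)
    fix P u Q v
    assume *: "P \<subseteq> W" "card P = 2" "u \<in> D (col P)" "Q \<subseteq> W" "card Q = 2" "v \<in> D (col Q)"
      and eq: "insert u P = insert v Q"
    have "u \<in> U" "v \<in> U" using * D by blast+
    then have "P = insert u P \<inter> W" "Q = insert v Q \<inter> W" "{u} = insert u P \<inter> U" "{v} = insert v Q \<inter> U"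
      using * disj by auto
    then show "P = Q \<and> u = v" using eq by (metis singleton_inject)
  qed
  moreover have "{insert u P | u P. P \<subseteq> W \<and> card P = 2 \<and> u \<in> D (col P)} = (\<lambda>(P, u). insert u P) ` ?S"
    by (auto simp: image_iff)
  ultimately have "card {insert u P | u P. P \<subseteq> W \<and> card P = 2 \<and> u \<in> D (col P)} = card ?S"
    by (simp add: card_image)
  also have "\<dots> = (\<Sum>P\<in>{P. P \<subseteq> W \<and> card P = 2}. card (D (col P)))"
    using W D by (intro card_SigmaI) (auto intro: card_ge_0_finite)
  also have "\<dots> = 2 * (card W choose 2)"
    using W D by (simp add: n_subsets)
  finally show ?thesis by (simp add: two_times_choose_two)
qed

text \<open>Here \<open>U\<close> is \<open>{..<m}\<close> and \<open>W\<close> consists of the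
  \<open>w\<close> new vertices. The loss \<open>2 * w\<close> pays for the discarded triples; it
  stands on the right to keep truncated subtraction away.\<close>

lemma spread_step:
  fixes m w :: nat
  assumes w: "2 * w \<le> m" and G: "rgraph 3 ({..<m}, E)" and E: "spread E"
  shows "\<exists>E'. rgraph 3 ({..<m + w}, E') \<and> spread E' \<and> card E + w * (w - 1) \<le> card E' + 2 * w"
proof -
  define W where "W = {m..<m + w}"
  define col where "col P = \<Sum>P mod w" for P :: "nat set"
  \<comment> \<open>For \<open>i < w\<close> these disjoint pairs fit into \<open>{..<m}\<close>
    because \<open>2 * w \<le> m\<close>.\<close>
  define D where "D i = {2 * i, 2 * i + 1}" for i :: nat
  define T where "T = {insert u P | u P. P \<subseteq> W \<and> card P = 2 \<and> u \<in> D (col P)}"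
  define X where "X = (\<Union>i<w. {A \<in> E. D i \<subseteq> A})"
  have triples: "A \<subseteq> {..<m}" "card A = 3" if "A \<in> E" for A
    using G that by (auto simp: rgraph_def)
  have finE: "finite E"
    using triples by (intro finite_subset[of E "Pow {..<m}"]) auto
  have cardD: "card (D i) = 2" for i
    by (simp add: D_def)
  have col: "col P < w" if "P \<subseteq> W" "card P = 2" for P
  proof -
    \<comment> \<open>For \<open>w = 0\<close> the operation \<open>mod w\<close> would return the
      sum itself; a pair inside \<open>W\<close> excludes that case.\<close>
    have "P \<noteq> {}" using that by auto
    then have "0 < w" using that by (auto simp: W_def)
    then show ?thesis by (simp add: col_def)
  qed
  have D: "D (col P) \<subseteq> {..<m} \<and> card (D (col P)) = 2" if "P \<subseteq> W" "card P = 2" for P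
    using col[OF that] w cardD by (auto simp: D_def)
  have disj: "{..<m} \<inter> W = {}" by (auto simp: W_def)
  have D_disj: "i = j" if "D i \<inter> D j \<noteq> {}" for i j
    using that by (auto simp: D_def)
  have cardT: "card T = w * (w - 1)"
    unfolding T_def using card_twin_family[of W "{..<m}" D col] disj D by (simp add: W_def)
  have T_sub: "A \<subseteq> {..<m + w} \<and> card A = 3 \<and> A \<inter> W \<noteq> {}" if A: "A \<in> T" for A
  proof -
    obtain u P where *: "A = insert u P" "P \<subseteq> W" "card P = 2" "u \<in> D (col P)"
      using A by (auto simp: T_def)
    then have "u < m" "finite P" using D by (auto intro: card_ge_0_finite)
    moreover from * \<open>u < m\<close> have "u \<notin> P" by (auto simp: W_def)
    moreover have "P \<noteq> {}" using *(3) by auto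
    then have "A \<inter> W \<noteq> {}" using *(1,2) by blast
    ultimately show ?thesis using * by (auto simp: W_def)
  qed
  have finT: "finite T"
    using T_sub by (intro finite_subset[of T "Pow {..<m + w}"]) auto
  have cardX: "card X \<le> 2 * w"
  proof -
    have "card X \<le> (\<Sum>i<w. card {A \<in> E. D i \<subseteq> A})"
      unfolding X_def by (rule card_UN_le) simp
    also have "\<dots> \<le> (\<Sum>i<w. 2)"
      using spread_codegree[OF triples(2) E finE cardD] by (intro sum_mono)
    finally show ?thesis by simp
  qed
  have "spread ((E - X) \<union> T)"
  proof (rule spread_twin_extension[where col = col and D = D, OF disj _ D _ _ _ _ _ T_def])
    show "P = Q" if "P \<subseteq> W" "Q \<subseteq> W" "card P = 2" "card Q = 2" "P \<inter> Q \<noteq> {}" "col P = col Q" for P Q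
      using sum_mod_proper[of P m w Q] that by (simp add: W_def col_def)
    show "spread (E - X)" using E by (auto simp: spread_def)
    show "\<not> D (col P) \<subseteq> A" if "A \<in> E - X" "P \<subseteq> W" "card P = 2" for A P
      using that col by (auto simp: X_def)
  qed (use triples D_disj in auto)
  moreover have "rgraph 3 ({..<m + w}, (E - X) \<union> T)"
    using triples T_sub by (fastforce simp: rgraph_def)
  moreover have "card E + w * (w - 1) \<le> card ((E - X) \<union> T) + 2 * w"
  proof -
    have "(E - X) \<inter> T = {}" using triples(1) T_sub disj by blast
    then have "card ((E - X) \<union> T) = card (E - X) + card T"
      using finE finT by (intro card_Un_disjoint) auto
    moreover have "X \<subseteq> E" by (auto simp: X_def)
    then have "card (E - X) = card E - card X"
      using finE by (intro card_Diff_subset) (auto intro: finite_subset)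
    ultimately show ?thesis using cardT cardX by simp
  qed
  ultimately show ?thesis by (intro exI conjI)
qed

section \<open>The recursion for the lower bound\<close>

lemma spread_exists:
  "\<exists>E. rgraph 3 ({..<n}, E) \<and> spread E \<and> real n ^ 2 / 5 - 4 * real n \<le> real (card E)"
proof (induction n rule: less_induct)
  case (less n)
  show ?case
  proof (cases "n \<le> 20")
    \<comment> \<open>Up to 20 the claimed bound is not positive, so the empty edge set
      works.\<close>
    case True
    then have "real n * real n \<le> 20 * real n"
      by (intro mult_right_mono) auto
    then show ?thesis
      by (intro exI[of _ "{}"]) (simp add: rgraph_def spread_def power2_eq_square)
  next
    case False
    \<comment> \<open>With \<open>m\<close> close to \<open>2 * w\<close>, the w(w-1)/2 twins use
      four cross pairs each, nearly all \<open>w * m\<close> of them.\<close>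
    define w m r where "w = n div 3" and "m = n - w" and "r = n mod 3"
    have n: "n = 3 * w + r" "m = 2 * w + r" "r \<le> 2" "0 < w"
      using False unfolding w_def m_def r_def by presburger+
    obtain E where E: "rgraph 3 ({..<m}, E)" "spread E" "real m ^ 2 / 5 - 4 * real m \<le> real (card E)"
      using less.IH[of m] n by auto
    obtain E' where E': "rgraph 3 ({..<m + w}, E')" "spread E'"
        "card E + w * (w - 1) \<le> card E' + 2 * w"
      using spread_step[OF _ E(1,2), of w] n by auto
    have "real w * (real w - 1) = real (w * (w - 1))"
      using n by (simp add: of_nat_diff)
    then have "real (card E) + real w * (real w - 1) \<le> real (card E') + 2 * real w"
      using E'(3) by linarith
    moreover have "real w * real r \<le> real w * 2"
      using n by (intro mult_left_mono) auto
    \<comment> \<open>The quadratic terms differ by w^2 + 2wr/5. The constant 4 allows a loss of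
      \<open>4 * w\<close> against an actual \<open>3 * w\<close>; the spare \<open>w\<close>
      absorbs 2wr/5 \<le> 4w/5, so the last bracket is not positive.\<close>
    moreover have "real n ^ 2 / 5 - 4 * real n =
      real m ^ 2 / 5 - 4 * real m + real w * (real w - 1) - 2 * real w + (2 * (real w * real r) / 5 - real w)"
      unfolding n(1,2) by (simp add: power2_eq_square field_simps)
    ultimately have "real n ^ 2 / 5 - 4 * real n \<le> real (card E')"
      using E(3) by linarith
    moreover have "m + w = n" using n by simp
    ultimately show ?thesis using E' by auto
  qed
qed

section \<open>Bounds for the extremal number and the limit\<close>

lemma f_num_bounds:
  assumes n: "5 \<le> n"
  shows "real n ^ 2 / 5 - 4 * real n \<le> real (f_num 3 n 5 3)"
    and "real (f_num 3 n 5 3) \<le> real n ^ 2 / 5"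
proof -
  define S where "S = {card (edges G) | G :: nat hgraph.
    rgraph 3 G \<and> card (verts G) = n \<and> free_of (graph_family 3 5 3) G}"
  \<comment> \<open>Finiteness and nonemptiness make \<open>Max S\<close> an attained maximum, so
    the lower bound needs one witness and the upper bound one extremal graph.\<close>
  have S: "finite S" "S \<noteq> {}" and f: "f_num 3 n 5 3 = Max S"
    using ex_num_well_defined[of 3 3 n 5] by (simp_all add: S_def f_num_def ex_num_def)
  obtain E where E: "rgraph 3 ({..<n}, E)" "spread E" "real n ^ 2 / 5 - 4 * real n \<le> real (card E)"
    using spread_exists by blast
  have "card (edges ({..<n}, E)) \<in> S"
    unfolding S_def using E spread_imp_free_of[of "({..<n}, E)" 3]
    by (intro CollectI exI[of _ "({..<n}, E)"]) simp
  then have "card E \<le> Max S" using S by simp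
  then show "real n ^ 2 / 5 - 4 * real n \<le> real (f_num 3 n 5 3)"
    using E(3) f by linarith
  have "Max S \<in> S" using S by simp
  then obtain G :: "nat hgraph" where G: "Max S = card (edges G)" "rgraph 3 G" "card (verts G) = n"
      "free_of (graph_family 3 5 3) G"
    unfolding S_def by blast
  have "5 * card (edges G) \<le> n * (n - 1)"
    using spread_card_le[of "verts G" "edges G"] free_of_imp_spread[of G] G n by (auto simp: rgraph_def)
  also have "\<dots> \<le> n * n" by simp
  finally have "5 * f_num 3 n 5 3 \<le> n ^ 2" using f G by (simp add: power2_eq_square)
  then have "real (5 * f_num 3 n 5 3) \<le> real (n ^ 2)" by (simp only: of_nat_le_iff)
  then show "real (f_num 3 n 5 3) \<le> real n ^ 2 / 5" by simp
qed

theorem theorem2: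
  shows "(\<lambda>n::nat. real (f_num 3 n 5 3) / (real n)\<^sup>2) \<longlonglongrightarrow> 1 / 5"
proof (rule tendsto_sandwich)
  \<comment> \<open>Dividing by n^2 turns the linear loss into 4/n, which vanishes in the
    limit.\<close>
  show "\<forall>\<^sub>F n in sequentially. 1 / 5 - 4 * inverse (real n) \<le> real (f_num 3 n 5 3) / (real n)\<^sup>2"
    using eventually_ge_at_top[of 5]
  proof eventually_elim
    case (elim n)
    then have "1 / 5 - 4 * inverse (real n) = (real n ^ 2 / 5 - 4 * real n) / (real n)\<^sup>2"
      by (simp add: field_simps power2_eq_square)
    also have "\<dots> \<le> real (f_num 3 n 5 3) / (real n)\<^sup>2"
      using f_num_bounds(1)[OF elim] by (intro divide_right_mono) auto
    finally show ?case .
  qed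
  show "\<forall>\<^sub>F n in sequentially. real (f_num 3 n 5 3) / (real n)\<^sup>2 \<le> 1 / 5"
    using eventually_ge_at_top[of 5]
  proof eventually_elim
    case (elim n)
    then show ?case
      using f_num_bounds(2)[OF elim] by (simp add: field_simps)
  qed
  show "(\<lambda>n. 1 / 5 - 4 * inverse (real n)) \<longlonglongrightarrow> 1 / 5"
    using tendsto_diff[OF tendsto_const tendsto_mult_right_zero[OF lim_inverse_n[where 'a = real], of 4], of "1 / 5"]
    by simp
qed simp

end
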